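(* Let $N$ be a non-zero real number and let the polynomials $Q_n(N,x)$ in $x$ be defined by $$\frac{1}{1-(N^{2}x^{2}+N^{2}-1)t-N^{2}t^{2}}=\sum_{n=0}^{\infty}Q_n(N,x)t^{n}.$$ Then for all integers $n\ge 1$, all the (complex) zeros of the polynomial $Q_n(N,\cdot)$ lie on the hyperbola $$y^{2}-x^{2}=\frac{N^{2}-1}{N^{2}},$$ i.e. if $z=x+iy$ with $x,y\in\mathbb{R}$ and $Q_n(N,z)=0$, then $y^2-x^2=\frac{N^2-1}{N^2}$.
   Context: The generating function is an identity of formal power series in $t$ with coefficients in $\mathbb{R}[x]$. A complex number $z=x+iy$ is identified with the point $(x,y)$ of the plane. *)

theory Defs
  imports Complex_Main
    "HOL-Computational_Algebra.Polynomial"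
    "HOL-Computational_Algebra.Formal_Power_Series"
begin

definition Q_denom :: "real \<Rightarrow> real poly fps" where
  "Q_denom N = 1 - fps_const [:N\<^sup>2 - 1, 0, N\<^sup>2:] * fps_X - fps_const [:N\<^sup>2:] * fps_X\<^sup>2"

(* The coefficient ring of polynomials is not of class inverse, so division of power series
   is not available here; the second argument 1 of fps_right_inverse is the inverse of the
   constant coefficient of the denominator. *)
definition Q :: "real \<Rightarrow> nat \<Rightarrow> real poly" where
  "Q N n = fps_nth (fps_right_inverse (Q_denom N) 1) n"

lemma Q_generating_function: "Q_denom N * Abs_fps (Q N) = 1"
proof -
  have "Abs_fps (Q N) = fps_right_inverse (Q_denom N) 1"
    unfolding Q_def by (rule fps_nth_inverse)
  moreover have "Q_denom N * fps_right_inverse (Q_denom N) 1 = 1"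
    by (rule fps_right_inverse) (simp add: Q_denom_def)
  ultimately show ?thesis
    by (rule ssubst)
qed

lemma Q_unique: "Q_denom N * Abs_fps P = 1 \<longleftrightarrow> P = Q N"
proof
  assume P: "Q_denom N * Abs_fps P = 1"
  have "Abs_fps P = (Q_denom N * Abs_fps (Q N)) * Abs_fps P"
    unfolding Q_generating_function by (rule mult_1_left[symmetric])
  also have "\<dots> = (Q_denom N * Abs_fps P) * Abs_fps (Q N)"
    by (simp only: ac_simps)
  also have "\<dots> = Abs_fps (Q N)"
    unfolding P by (rule mult_1_left)
  finally have "fps_nth (Abs_fps P) = fps_nth (Abs_fps (Q N))"
    by (rule arg_cong)
  then show "P = Q N"
    by (simp only: fps_nth_Abs_fps[abs_def] fps_nth_Abs_fps)
next
  assume "P = Q N"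
  then show "Q_denom N * Abs_fps P = 1"
    by (simp only: Q_generating_function)
qed

end

theory Submission
  imports Defs
begin

text \<open>
  Put \<open>w = N\<^sup>2z\<^sup>2 + N\<^sup>2 - 1\<close>, so that \<open>q\<^sub>n = Q\<^sub>n(N,z)\<close> satisfies
  \<open>q\<^sub>n\<^sub>+\<^sub>2 = w q\<^sub>n\<^sub>+\<^sub>1 + N\<^sup>2 q\<^sub>n\<close>. The ratios obey \<open>q\<^sub>n\<^sub>+\<^sub>2 / q\<^sub>n\<^sub>+\<^sub>1 = w + N\<^sup>2 / (q\<^sub>n\<^sub>+\<^sub>1 / q\<^sub>n)\<close>, so if
  \<open>Re w \<noteq> 0\<close> their real parts all keep the sign of \<open>Re w\<close> and no \<open>q\<^sub>n\<close> vanishes. Hence a zero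
  has \<open>Re w = 0\<close>, which is the equation of the hyperbola.
\<close>

lemma Q_0: "Q N 0 = 1"
  using arg_cong[OF Q_generating_function[of N], of "\<lambda>f. fps_nth f 0"]
  by (simp add: Q_denom_def fps_mult_nth_0)

lemma Q_denom_mult_nth:
  "fps_nth (Q_denom N * f) n = fps_nth f n
     - (if n = 0 then 0 else [:N\<^sup>2 - 1, 0, N\<^sup>2:] * fps_nth f (n - 1))
     - (if n < 2 then 0 else [:N\<^sup>2:] * fps_nth f (n - 2))"
  by (simp add: Q_denom_def left_diff_distrib mult.assoc fps_X_power_mult_nth
      del: mult_pCons_left)

lemma Q_1: "Q N (Suc 0) = [:N\<^sup>2 - 1, 0, N\<^sup>2:]"
  using arg_cong[OF Q_generating_function[of N], of "\<lambda>f. fps_nth f (Suc 0)"]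
  by (simp add: Q_denom_mult_nth Q_0 del: mult_pCons_left fps_mult_nth_1 fps_mult_nth_1')

lemma Q_Suc_Suc:
  "Q N (Suc (Suc n)) = [:N\<^sup>2 - 1, 0, N\<^sup>2:] * Q N (Suc n) + [:N\<^sup>2:] * Q N n"
  using arg_cong[OF Q_generating_function[of N], of "\<lambda>f. fps_nth f (Suc (Suc n))"]
  by (simp add: Q_denom_mult_nth algebra_simps del: mult_pCons_left)

lemma map_poly_of_real_add:
  "map_poly complex_of_real (p + q) = map_poly of_real p + map_poly of_real q"
  by (rule poly_eqI) (simp add: coeff_map_poly)

lemma map_poly_of_real_mult:
  "map_poly complex_of_real (p * q) = map_poly of_real p * map_poly of_real q"
  by (rule poly_eqI) (simp add: coeff_map_poly coeff_mult)

lemma Re_three_term_recurrence_pos: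
  fixes q :: "nat \<Rightarrow> complex"
  assumes "q 0 = 1" "q (Suc 0) = w"
    and rec: "\<And>n. q (Suc (Suc n)) = w * q (Suc n) + of_real c * q n"
    and "c \<ge> 0" "Re w \<noteq> 0"
  shows "Re w * Re (q (Suc n) * cnj (q n)) > 0"
proof (induction n)
  case 0
  then show ?case using assms by (auto simp: zero_less_mult_iff)
next
  case (Suc n)
  have nz: "q (Suc n) \<noteq> 0"
    using Suc.IH by auto
  have "Re w * Re (q (Suc (Suc n)) * cnj (q (Suc n)))
      = (Re w)\<^sup>2 * (cmod (q (Suc n)))\<^sup>2 + c * (Re w * Re (q (Suc n) * cnj (q n)))"
    unfolding rec cmod_power2 by (simp add: algebra_simps power2_eq_square)
  moreover have "(Re w)\<^sup>2 * (cmod (q (Suc n)))\<^sup>2 > 0"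
    using nz \<open>Re w \<noteq> 0\<close> by simp
  moreover have "c * (Re w * Re (q (Suc n) * cnj (q n))) \<ge> 0"
    by (rule mult_nonneg_nonneg[OF \<open>c \<ge> 0\<close> less_imp_le[OF Suc.IH]])
  ultimately show ?case by linarith
qed

theorem theorem7:
  fixes N x y :: real and n :: nat
  assumes "N \<noteq> 0"
    and "n \<ge> 1"
    and "poly (map_poly complex_of_real (Q N n)) (Complex x y) = 0"
  shows "y\<^sup>2 - x\<^sup>2 = (N\<^sup>2 - 1) / N\<^sup>2"
proof -
  define z where "z = Complex x y"
  define w where "w = of_real (N\<^sup>2 - 1) + of_real (N\<^sup>2) * z\<^sup>2"
  define q where "q n = poly (map_poly complex_of_real (Q N n)) z" for n
  have w: "poly (map_poly complex_of_real [:N\<^sup>2 - 1, 0, N\<^sup>2:]) z = w"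
    by (simp add: w_def map_poly_pCons power2_eq_square algebra_simps)
  have q0: "q 0 = 1"
    by (simp add: q_def Q_0)
  have q1: "q (Suc 0) = w"
    unfolding q_def Q_1 by (rule w)
  have rec: "q (Suc (Suc n)) = w * q (Suc n) + of_real (N\<^sup>2) * q n" for n
    unfolding q_def Q_Suc_Suc map_poly_of_real_add map_poly_of_real_mult poly_add poly_mult w
    by (simp add: map_poly_pCons)
  obtain m where m: "n = Suc m"
    using assms(2) by (cases n) auto
  have "q (Suc m) = 0"
    using assms(3) by (simp add: q_def z_def m)
  then have "Re w = 0"
    using Re_three_term_recurrence_pos[OF q0 q1 rec, of m] by force
  then have "N\<^sup>2 - 1 + N\<^sup>2 * (x\<^sup>2 - y\<^sup>2) = 0"
    by (simp add: w_def z_def power2_eq_square)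
  then show ?thesis
    using assms(1) by (simp add: field_simps)
qed

end
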